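(* In the setting described in the context, assume that $v:[0,T]\times E\to\mathbb R$ is continuous and let $(t,x)\in[0,T]\times E$. (i) For $\tau\in\mathcal T_{t,T}$ it holds that $$v(t,x)=B_t\,\mathcal E_{t,x}\big[\varrho(t,\tau,X,B)+B_\tau^{-1}f(X_\tau)\big]$$ if and only if $\{\tau\in t_*(X_\tau)\}$ is a full $(t,x)$-scenario. In this case, $u(t,x)=v(t,x)$. (ii) For $\tau\in\mathcal T_{t,T}$ it holds that $$v(t,x)=B_t\,\mathcal E_{t,x}\big[\varrho(t,\tau,X,B)+B_\tau^{-1}h(X_\tau)\big]$$ if and only if $\{\tau\in t^*(X_\tau)\}$ is a full $(t,x)$-scenario. In this case, $w(t,x)=v(t,x)$.
   Context: Setting. $E$ is a Polish space, $(\Omega,\mathcal F)$ is a measurable space of $E$-valued paths indexed by time, $X$ is the coordinate process $X_t(\omega)=\omega(t)$, and $(\mathcal F_t)_{t\ge0}$ is the filtration generated by $X$. $\mathcal L^0(\Omega)$ denotes the measurable functions $\Omega\to\mathbb R$ and $\mathcal L^\infty(\Omega)$ the bounded ones. $B:[0,\infty)\to(0,\infty)$ is such that $B$ and $1/B$ are bounded on bounded sets, and $B$ is continuous on $[0,T]$. Fix $T\in(0,\infty)$. For $t\in[0,T]$, $\mathcal T_{t,T}$ is a class of $[t,T]$-valued random variables on $\Omega$ (admissible stopping rules), with $\mathcal T_{t,T}\subseteq\mathcal T_{s,T}$ for $s\le t$, and $X_\tau$ is measurable for each $\tau\in\mathcal T_{0,T}$. $\mathcal H$ is a linear subspace of $\mathcal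 L^0(\Omega)$ with $\mathbf 1_\Omega\in\mathcal H$ and $YZ\in\mathcal H$ for all $Y\in\mathcal H$, $Z\in\mathcal L^\infty(\Omega)$. For each $(t,x)\in[0,T]\times E$ there is given a (possibly nonlinear) map $\mathcal E_{t,x}:\mathcal H\to\mathbb R$. An event $A\in\mathcal F$ is called a full $(t,x)$-scenario if $\mathcal E_{t,x}[Y\mathbf 1_A]=\mathcal E_{t,x}[Y]$ for all $Y\in\mathcal H$. Let $\varrho:[0,T]\times[0,T]\times\Omega\times C([0,T];\mathbb R)\to\mathbb R$ and $g:E\to\mathbb R$ be measurable, with $g(X_T)\in\mathcal H$ and $\varrho(t,\tau,X,B)\in\mathcal H$ for all $t\in[0,T]$, $\tau\in\mathcal T_{t,T}$ and for $\tau=T$. Define $$v(t,x):=B_t\,\mathcal E_{t,x}\big[\varrho(t,T,X,B)+B_T^{-1}g(X_T)\big],\quad f(x):=\inf_{0\le t\le T}v(t,x),\quad h(x):=\sup_{0\le t\le T}v(t,x),$$ $$u(t,x):=\sup_{\tau\in\mathcal T_{t,T}}B_t\,\mathcal E_{t,x}\big[\varrho(t,\tau,X,B)+B_\tau^{-1}f(X_\tau)\big],\quad w(t,x):=\inf_{\tau\in\mathcal T_{t,T}}B_t\,\mathcal E_{t,x}\big[\varrho(t,\tau,X,B)+B_\tau^{-1}h(X_\tau)\big].$$ For continuous $v$ define the sets $t_*(x):=\operatorname{arg\,min}\{v(t,x):0\le t\le T\}$ and $t^*(x):=\operatorname{arg\,max}\{v(t,x):0\le t\le T\}$, $x\in E$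 (nonempty compact subsets of $[0,T]$). Assumptions, for all $(t,x)\in[0,T]\times E$: (E.I) $\mathcal E_{t,x}[c]=c$ for every constant $c\in\mathbb R$. (E.II) $\mathcal E_{t,x}[Y]\le\mathcal E_{t,x}[Y']$ for all $Y,Y'\in\mathcal H$ with $Y\le Y'$. (E.III) If $Y,Y'\in\mathcal H$, $Y\le Y'$ and $\mathcal E_{t,x}[Y]=\mathcal E_{t,x}[Y']$, then $\{Y=Y'\}$ is a full $(t,x)$-scenario. (E.IV) $\{X_t=x\}$ is a full $(t,x)$-scenario. (E.V) For each $\tau\in\mathcal T_{0,T}$: $v(\tau,X_\tau)$, $\inf_{0\le s\le T}v(s,X_\tau)$ and $\sup_{0\le s\le T}v(s,X_\tau)$ belong to $\mathcal H$. (E.VI) (dynamic programming principle) For each $\tau\in\mathcal T_{t,T}$: $v(t,x)=B_t\,\mathcal E_{t,x}\big[\varrho(t,\tau,X,B)+B_\tau^{-1}v(\tau,X_\tau)\big]$. *)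

theory Defs
  imports "HOL-Analysis.Analysis"
begin

text \<open>Borel sigma-algebra of \<open>C([0,T];\<real>)\<close> for the supremum metric. Its points are
  the continuous functions on \<open>{0..T}\<close>, extended by \<^term>\<open>undefined\<close> outside.\<close>
definition C_borel :: "real \<Rightarrow> (real \<Rightarrow> real) measure" where
  "C_borel T = (let C = cfunspace (top_of_set {0..T}) euclidean_metric
                in sigma (mspace C) {U. openin (mtopology_of C) U})"

text \<open>Functions on \<open>\<Omega> = space M\<close> are represented by extensional functions, so that a set of
  random variables, and a map defined on it, sees nothing of the points outside \<open>\<Omega>\<close>.\<close>
definition L0 :: "'w measure \<Rightarrow> ('w \<Rightarrow> real) set" where
  "L0 M = {Y \<in> borel_measurable M. Y \<in> extensional (space M)}"

definition Linf :: "'w measure \<Rightarrow> ('w \<Rightarrow> real) set" where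
  "Linf M = {Y \<in> L0 M. bounded (Y ` space M)}"

text \<open>
  \<^item> \<open>M\<close>: the measurable space \<open>(\<Omega>, \<F>)\<close>; no measure on it is used.
  \<^item> \<open>\<T> t\<close>: the class of admissible stopping rules with values in \<open>[t,T]\<close>.
  \<^item> \<open>EE t x\<close>: the nonlinear expectation, relevant only on the set \<open>H\<close>.
  \<^item> \<open>rho t s \<omega> b\<close>: here \<open>b\<close> is an element of \<open>C([0,T];\<real>)\<close>.
\<close>
locale path_setting =
  fixes M :: "(real \<Rightarrow> 'e::polish_space) measure"
    and T :: real
    and B :: "real \<Rightarrow> real"
    and \<T> :: "real \<Rightarrow> ((real \<Rightarrow> 'e) \<Rightarrow> real) set"
    and H :: "((real \<Rightarrow> 'e) \<Rightarrow> real) set"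
    and EE :: "real \<Rightarrow> 'e \<Rightarrow> ((real \<Rightarrow> 'e) \<Rightarrow> real) \<Rightarrow> real"
    and rho :: "real \<Rightarrow> real \<Rightarrow> (real \<Rightarrow> 'e) \<Rightarrow> (real \<Rightarrow> real) \<Rightarrow> real"
    and g :: "'e \<Rightarrow> real"
begin

text \<open>The discounted reward \<open>\<rho>(t,\<tau>,X,B) + B\<^sub>\<tau>\<inverse> Y\<close> as a function on \<open>\<Omega>\<close>.\<close>
definition reward :: "real \<Rightarrow> ((real \<Rightarrow> 'e) \<Rightarrow> real) \<Rightarrow> ((real \<Rightarrow> 'e) \<Rightarrow> real) \<Rightarrow> (real \<Rightarrow> 'e) \<Rightarrow> real" where
  "reward t \<tau> Y = (\<lambda>\<omega>\<in>space M. rho t (\<tau> \<omega>) \<omega> (restrict B {0..T}) + inverse (B (\<tau> \<omega>)) * Y \<omega>)"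

definition v :: "real \<Rightarrow> 'e \<Rightarrow> real" where
  "v t x = B t * EE t x (reward t (\<lambda>\<omega>. T) (\<lambda>\<omega>. g (\<omega> T)))"

definition f :: "'e \<Rightarrow> real" where
  "f x = (INF t\<in>{0..T}. v t x)"

definition h :: "'e \<Rightarrow> real" where
  "h x = (SUP t\<in>{0..T}. v t x)"

text \<open>In \<open>u\<close> and \<open>w\<close> the supremum and infimum are taken in the extended reals, so that
  they have their usual meaning for unbounded and for empty sets.\<close>
definition u :: "real \<Rightarrow> 'e \<Rightarrow> ereal" where
  "u t x = (SUP \<tau>\<in>\<T> t. ereal (B t * EE t x (reward t \<tau> (\<lambda>\<omega>. f (\<omega> (\<tau> \<omega>))))))"

definition w :: "real \<Rightarrow> 'e \<Rightarrow> ereal" where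
  "w t x = (INF \<tau>\<in>\<T> t. ereal (B t * EE t x (reward t \<tau> (\<lambda>\<omega>. h (\<omega> (\<tau> \<omega>))))))"

definition t_min :: "'e \<Rightarrow> real set" where
  "t_min x = {s. is_arg_min (\<lambda>s. v s x) (\<lambda>s. s \<in> {0..T}) s}"

definition t_max :: "'e \<Rightarrow> real set" where
  "t_max x = {s. is_arg_max (\<lambda>s. v s x) (\<lambda>s. s \<in> {0..T}) s}"

definition full_scenario :: "real \<Rightarrow> 'e \<Rightarrow> (real \<Rightarrow> 'e) set \<Rightarrow> bool" where
  "full_scenario t x A \<longleftrightarrow> A \<in> sets M \<and>
     (\<forall>Y\<in>H. EE t x (\<lambda>\<omega>\<in>space M. Y \<omega> * indicator A \<omega>) = EE t x Y)"

end

text \<open>Measurability of the coordinates (\<open>coord_meas\<close>) says that the filtration generated by the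
  coordinate process consists of sub-sigma-algebras of \<open>M\<close>.\<close>
locale nonlinear_expectation_setting = path_setting +
  assumes paths: "space M \<subseteq> extensional {0..}"
    and coord_meas: "\<And>t. 0 \<le> t \<Longrightarrow> (\<lambda>\<omega>. \<omega> t) \<in> borel_measurable M"
    and T_pos: "0 < T"
    and B_pos: "\<And>t. 0 \<le> t \<Longrightarrow> 0 < B t"
    and B_bounded: "\<And>S. S \<subseteq> {0..} \<Longrightarrow> bounded S \<Longrightarrow> bounded (B ` S)"
    and inverse_B_bounded: "\<And>S. S \<subseteq> {0..} \<Longrightarrow> bounded S \<Longrightarrow> bounded ((\<lambda>t. 1 / B t) ` S)"
    and B_cont: "continuous_on {0..T} B"
    and rules: "\<And>t. t \<in> {0..T} \<Longrightarrow> \<T> t \<subseteq> {\<tau> \<in> L0 M. \<tau> \<in> space M \<rightarrow> {t..T}}"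
    and rules_antimono: "\<And>s t. 0 \<le> s \<Longrightarrow> s \<le> t \<Longrightarrow> t \<le> T \<Longrightarrow> \<T> t \<subseteq> \<T> s"
    and stopped_meas: "\<And>\<tau>. \<tau> \<in> \<T> 0 \<Longrightarrow> (\<lambda>\<omega>. \<omega> (\<tau> \<omega>)) \<in> borel_measurable M"
    and H_L0: "H \<subseteq> L0 M"
    and H_one: "(\<lambda>\<omega>\<in>space M. 1) \<in> H"
    and H_add: "\<And>Y Y'. Y \<in> H \<Longrightarrow> Y' \<in> H \<Longrightarrow> (\<lambda>\<omega>\<in>space M. Y \<omega> + Y' \<omega>) \<in> H"
    and H_scale: "\<And>Y (c::real). Y \<in> H \<Longrightarrow> (\<lambda>\<omega>\<in>space M. c * Y \<omega>) \<in> H"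
    and H_mult: "\<And>Y Z. Y \<in> H \<Longrightarrow> Z \<in> Linf M \<Longrightarrow> (\<lambda>\<omega>\<in>space M. Y \<omega> * Z \<omega>) \<in> H"
    and rho_meas: "(\<lambda>(t, s, \<omega>, b). rho t s \<omega> b) \<in> borel_measurable
      (restrict_space borel {0..T} \<Otimes>\<^sub>M restrict_space borel {0..T} \<Otimes>\<^sub>M M \<Otimes>\<^sub>M C_borel T)"
    and g_meas: "g \<in> borel_measurable borel"
    and g_H: "(\<lambda>\<omega>\<in>space M. g (\<omega> T)) \<in> H"
    and rho_H: "\<And>t \<tau>. t \<in> {0..T} \<Longrightarrow> \<tau> \<in> \<T> t \<Longrightarrow>
      (\<lambda>\<omega>\<in>space M. rho t (\<tau> \<omega>) \<omega> (restrict B {0..T})) \<in> H"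
    and rho_H_T: "\<And>t. t \<in> {0..T} \<Longrightarrow>
      (\<lambda>\<omega>\<in>space M. rho t T \<omega> (restrict B {0..T})) \<in> H"
    and E_I: "\<And>t x c. t \<in> {0..T} \<Longrightarrow> EE t x (\<lambda>\<omega>\<in>space M. c) = c"
    and E_II: "\<And>t x Y Y'. t \<in> {0..T} \<Longrightarrow> Y \<in> H \<Longrightarrow> Y' \<in> H \<Longrightarrow>
      (\<forall>\<omega>\<in>space M. Y \<omega> \<le> Y' \<omega>) \<Longrightarrow> EE t x Y \<le> EE t x Y'"
    and E_III: "\<And>t x Y Y'. t \<in> {0..T} \<Longrightarrow> Y \<in> H \<Longrightarrow> Y' \<in> H \<Longrightarrow>
      (\<forall>\<omega>\<in>space M. Y \<omega> \<le> Y' \<omega>) \<Longrightarrow> EE t x Y = EE t x Y' \<Longrightarrow>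
      full_scenario t x {\<omega>\<in>space M. Y \<omega> = Y' \<omega>}"
    and E_IV: "\<And>t x. t \<in> {0..T} \<Longrightarrow> full_scenario t x {\<omega>\<in>space M. \<omega> t = x}"
    and E_V: "\<And>\<tau>. \<tau> \<in> \<T> 0 \<Longrightarrow> (\<lambda>\<omega>\<in>space M. v (\<tau> \<omega>) (\<omega> (\<tau> \<omega>))) \<in> H"
      "\<And>\<tau>. \<tau> \<in> \<T> 0 \<Longrightarrow> (\<lambda>\<omega>\<in>space M. INF s\<in>{0..T}. v s (\<omega> (\<tau> \<omega>))) \<in> H"
      "\<And>\<tau>. \<tau> \<in> \<T> 0 \<Longrightarrow> (\<lambda>\<omega>\<in>space M. SUP s\<in>{0..T}. v s (\<omega> (\<tau> \<omega>))) \<in> H"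
    and E_VI: "\<And>t x \<tau>. t \<in> {0..T} \<Longrightarrow> \<tau> \<in> \<T> t \<Longrightarrow>
      v t x = B t * EE t x (reward t \<tau> (\<lambda>\<omega>. v (\<tau> \<omega>) (\<omega> (\<tau> \<omega>))))"

end

(* Continuity of v attains the infimum and supremum in f and h, so the rewards built from f, v, h
   are pointwise ordered and a pair of them agrees exactly on the event in the theorem. By strict
   monotonicity (E.III), ordered rewards have equal expectation iff they agree on a full scenario,
   and (E.VI) identifies the expectation of the reward built from v with the value v(t,x). *)
theory Submission
  imports Defs
begin

context nonlinear_expectation_setting
begin

lemma rule_range:
  assumes "t \<in> {0..T}" "\<tau> \<in> \<T> t" "\<omega> \<in> space M"
  shows "\<tau> \<omega> \<in> {0..T}"
  using assms subsetD[OF rules assms(2)] by (fastforce dest: funcset_mem)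

lemma rule_at_0:
  assumes "t \<in> {0..T}" "\<tau> \<in> \<T> t"
  shows "\<tau> \<in> \<T> 0"
  using assms rules_antimono[of 0 t] by auto

text \<open>Products stay in \<open>H\<close> when one factor is bounded and measurable, so the
  discount factor at a stopping rule has to be shown to be of this kind.\<close>

lemma inverse_B_rule_Linf:
  assumes "t \<in> {0..T}" "\<tau> \<in> \<T> t"
  shows "(\<lambda>\<omega>\<in>space M. inverse (B (\<tau> \<omega>))) \<in> Linf M"
proof -
  have "\<tau> \<in> borel_measurable M"
    using assms rules[of t] by (auto simp: L0_def)
  \<comment> \<open>\<open>B\<close> is continuous on \<open>{0..T}\<close> and may be irregular
    beyond it, so \<open>\<tau>\<close> is treated as a map into that interval with its trace Borel
    sets.\<close>
  then have \<tau>: "\<tau> \<in> measurable M (restrict_space borel {0..T})"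
    using rule_range[OF assms] by (intro measurable_restrict_space2) auto
  have "continuous_on {0..T} (\<lambda>s. inverse (B s))"
    using B_cont B_pos by (intro continuous_on_inverse) (auto simp: less_imp_neq[symmetric])
  then have "(\<lambda>s. inverse (B s)) \<in> borel_measurable (restrict_space borel {0..T})"
    by (rule borel_measurable_continuous_on_restrict)
  from measurable_compose[OF \<tau> this]
  have meas: "(\<lambda>\<omega>\<in>space M. inverse (B (\<tau> \<omega>))) \<in> borel_measurable M"
    by (simp cong: measurable_cong)
  have "bounded ((\<lambda>s. 1 / B s) ` {0..T})"
    by (rule inverse_B_bounded) auto
  then have "bounded ((\<lambda>\<omega>\<in>space M. inverse (B (\<tau> \<omega>))) ` space M)"
    by (rule bounded_subset) (use rule_range[OF assms] in \<open>auto simp: inverse_eq_divide\<close>)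
  with meas show ?thesis
    by (auto simp: Linf_def L0_def)
qed

lemma reward_H:
  assumes "t \<in> {0..T}" "\<tau> \<in> \<T> t" "restrict Y (space M) \<in> H"
  shows "reward t \<tau> Y \<in> H"
proof -
  \<comment> \<open>Both factors are restricted to \<open>space M\<close> because members of
    \<open>H\<close> are extensional; on \<open>space M\<close> this is the discounted term of
    \<open>reward\<close>.\<close>
  let ?D = "\<lambda>\<omega>\<in>space M. restrict Y (space M) \<omega> * (\<lambda>\<omega>\<in>space M. inverse (B (\<tau> \<omega>))) \<omega>"
  have "?D \<in> H"
    by (rule H_mult[OF assms(3) inverse_B_rule_Linf[OF assms(1,2)]])
  from H_add[OF rho_H[OF assms(1,2)] this] show ?thesis
    by (rule back_subst[of "\<lambda>Y. Y \<in> H"]) (auto simp: reward_def fun_eq_iff)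
qed

text \<open>The \<open>rho\<close> term is common to both sides and the discount factor is positive,
  so both cancel.\<close>

lemma reward_le_iff:
  assumes "t \<in> {0..T}" "\<tau> \<in> \<T> t" "\<omega> \<in> space M"
  shows "reward t \<tau> Y \<omega> \<le> reward t \<tau> Z \<omega> \<longleftrightarrow> Y \<omega> \<le> Z \<omega>"
  using assms B_pos[of "\<tau> \<omega>"] rule_range[OF assms]
  by (simp add: reward_def)

lemma reward_eq_iff:
  assumes "t \<in> {0..T}" "\<tau> \<in> \<T> t" "\<omega> \<in> space M"
  shows "reward t \<tau> Y \<omega> = reward t \<tau> Z \<omega> \<longleftrightarrow> Y \<omega> = Z \<omega>"
  using assms B_pos[of "\<tau> \<omega>"] rule_range[OF assms]
  by (simp add: reward_def)

lemma EE_reward_mono: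
  assumes "t \<in> {0..T}" "\<tau> \<in> \<T> t"
    and "restrict Y (space M) \<in> H" "restrict Z (space M) \<in> H"
    and "\<And>\<omega>. \<omega> \<in> space M \<Longrightarrow> Y \<omega> \<le> Z \<omega>"
  shows "EE t x (reward t \<tau> Y) \<le> EE t x (reward t \<tau> Z)"
  using assms by (intro E_II reward_H) (auto simp: reward_le_iff)

text \<open>Strict monotonicity \<open>E_III\<close> gives the forward direction. Conversely, a full
  scenario lets both rewards be cut down to the event where the payoffs agree, and there they are
  the same function.\<close>

lemma EE_reward_eq_iff:
  assumes "t \<in> {0..T}" "\<tau> \<in> \<T> t"
    and "restrict Y (space M) \<in> H" "restrict Z (space M) \<in> H"
    and "\<And>\<omega>. \<omega> \<in> space M \<Longrightarrow> Y \<omega> \<le> Z \<omega>"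
  shows "EE t x (reward t \<tau> Y) = EE t x (reward t \<tau> Z)
    \<longleftrightarrow> full_scenario t x {\<omega>\<in>space M. Y \<omega> = Z \<omega>}"
proof -
  let ?A = "{\<omega>\<in>space M. Y \<omega> = Z \<omega>}"
  note H = reward_H[OF assms(1,2)]
  have A: "{\<omega>\<in>space M. reward t \<tau> Y \<omega> = reward t \<tau> Z \<omega>} = ?A"
    using reward_eq_iff[OF assms(1,2)] by blast
  show ?thesis
  proof
    assume "EE t x (reward t \<tau> Y) = EE t x (reward t \<tau> Z)"
    then show "full_scenario t x ?A"
      unfolding A[symmetric]
      using assms H by (intro E_III) (auto simp: reward_le_iff)
  next
    assume "full_scenario t x ?A"
    then have cut: "EE t x (\<lambda>\<omega>\<in>space M. R \<omega> * indicator ?A \<omega>) = EE t x R" if "R \<in> H" for R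
      using that by (simp add: full_scenario_def)
    \<comment> \<open>Off \<open>?A\<close> both products vanish; on \<open>?A\<close> the payoffs,
      hence the rewards, coincide.\<close>
    have "(\<lambda>\<omega>\<in>space M. reward t \<tau> Y \<omega> * indicator ?A \<omega>)
        = (\<lambda>\<omega>\<in>space M. reward t \<tau> Z \<omega> * indicator ?A \<omega>)"
      by (auto simp: fun_eq_iff indicator_def reward_def)
    then show "EE t x (reward t \<tau> Y) = EE t x (reward t \<tau> Z)"
      using cut[OF H[OF assms(3)]] cut[OF H[OF assms(4)]] by simp
  qed
qed

text \<open>Compactness bounds each time slice, so the real-valued \<open>INF\<close> and
  \<open>SUP\<close> in \<open>f\<close> and \<open>h\<close> are genuine bounds for it.\<close>

lemma v_slice_compact:
  assumes "continuous_on ({0..T} \<times> UNIV) (\<lambda>(s, y). v s y)"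
  shows "compact ((\<lambda>s. v s y) ` {0..T})"
proof -
  have "continuous_on {0..T} (\<lambda>s. (\<lambda>(s, y). v s y) (s, y))"
    by (rule continuous_on_compose2[OF assms]) (auto intro!: continuous_intros)
  then show ?thesis
    by (auto intro!: compact_continuous_image)
qed

lemma f_le_v:
  assumes "continuous_on ({0..T} \<times> UNIV) (\<lambda>(s, y). v s y)" "s \<in> {0..T}"
  shows "f y \<le> v s y"
  unfolding f_def
  using assms(2) v_slice_compact[OF assms(1)]
  by (auto intro!: cINF_lower bounded_imp_bdd_below compact_imp_bounded)

lemma v_le_h:
  assumes "continuous_on ({0..T} \<times> UNIV) (\<lambda>(s, y). v s y)" "s \<in> {0..T}"
  shows "v s y \<le> h y"
  unfolding h_def
  using assms(2) v_slice_compact[OF assms(1)]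
  by (auto intro!: cSUP_upper bounded_imp_bdd_above compact_imp_bounded)

text \<open>If the infimum is the value at \<open>s\<close>, it bounds the slice from below, so
  \<open>s\<close> is a minimizer. If \<open>s\<close> is a minimizer, its value is a lower bound of
  the slice and so at most the infimum.\<close>

lemma f_eq_v_iff:
  assumes "continuous_on ({0..T} \<times> UNIV) (\<lambda>(s, y). v s y)" "s \<in> {0..T}"
  shows "f y = v s y \<longleftrightarrow> s \<in> t_min y"
proof
  assume "f y = v s y"
  then show "s \<in> t_min y"
    using f_le_v[OF assms(1), of _ y] assms(2) by (simp add: t_min_def is_arg_min_linorder)
next
  assume "s \<in> t_min y"
  \<comment> \<open>\<open>T_pos\<close> supplies the nonemptiness of \<open>{0..T}\<close> that
    \<open>cINF_greatest\<close> asks for.\<close>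
  then have "v s y \<le> f y"
    unfolding f_def by (intro cINF_greatest) (use T_pos in \<open>auto simp: t_min_def is_arg_min_linorder\<close>)
  with f_le_v[OF assms] show "f y = v s y"
    by (intro antisym)
qed

lemma v_eq_h_iff:
  assumes "continuous_on ({0..T} \<times> UNIV) (\<lambda>(s, y). v s y)" "s \<in> {0..T}"
  shows "v s y = h y \<longleftrightarrow> s \<in> t_max y"
proof
  assume "v s y = h y"
  then show "s \<in> t_max y"
    using v_le_h[OF assms(1), of _ y] assms(2) by (simp add: t_max_def is_arg_max_linorder)
next
  assume "s \<in> t_max y"
  then have "h y \<le> v s y"
    unfolding h_def by (intro cSUP_least) (use T_pos in \<open>auto simp: t_max_def is_arg_max_linorder\<close>)
  with v_le_h[OF assms] show "v s y = h y"
    by (intro antisym)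
qed

lemma stopped_value_H:
  assumes "t \<in> {0..T}" "\<tau> \<in> \<T> t"
  shows "(\<lambda>\<omega>\<in>space M. v (\<tau> \<omega>) (\<omega> (\<tau> \<omega>))) \<in> H"
    and "(\<lambda>\<omega>\<in>space M. f (\<omega> (\<tau> \<omega>))) \<in> H"
    and "(\<lambda>\<omega>\<in>space M. h (\<omega> (\<tau> \<omega>))) \<in> H"
  using E_V[OF rule_at_0[OF assms]] by (simp_all add: f_def h_def)

text \<open>Dynamic programming writes \<open>v t x\<close> as the discounted expectation with
  payoff \<open>v\<close> at the rule; lowering that payoff to \<open>f\<close> can only decrease
  it. Over all rules this bounds \<open>u\<close> by \<open>v\<close>.\<close>

lemma f_reward_le_v:
  assumes "continuous_on ({0..T} \<times> UNIV) (\<lambda>(s, y). v s y)" "t \<in> {0..T}" "\<tau> \<in> \<T> t"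
  shows "B t * EE t x (reward t \<tau> (\<lambda>\<omega>. f (\<omega> (\<tau> \<omega>)))) \<le> v t x"
  unfolding E_VI[OF assms(2,3)]
  using assms B_pos[of t]
  by (intro mult_left_mono EE_reward_mono[OF assms(2,3)] stopped_value_H[OF assms(2,3)]
      f_le_v[OF assms(1)] rule_range[OF assms(2,3)]) auto

lemma v_le_h_reward:
  assumes "continuous_on ({0..T} \<times> UNIV) (\<lambda>(s, y). v s y)" "t \<in> {0..T}" "\<tau> \<in> \<T> t"
  shows "v t x \<le> B t * EE t x (reward t \<tau> (\<lambda>\<omega>. h (\<omega> (\<tau> \<omega>))))"
  unfolding E_VI[OF assms(2,3)]
  using assms B_pos[of t]
  by (intro mult_left_mono EE_reward_mono[OF assms(2,3)] stopped_value_H[OF assms(2,3)]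
      v_le_h[OF assms(1)] rule_range[OF assms(2,3)]) auto

text \<open>By \<open>E_VI\<close> the claim compares the rewards with payoffs \<open>f\<close> and
  \<open>v\<close>, which are ordered, so it reduces to fullness of the event where these payoffs
  agree.\<close>

lemma v_eq_f_reward_iff:
  assumes "continuous_on ({0..T} \<times> UNIV) (\<lambda>(s, y). v s y)" "t \<in> {0..T}" "\<tau> \<in> \<T> t"
  shows "v t x = B t * EE t x (reward t \<tau> (\<lambda>\<omega>. f (\<omega> (\<tau> \<omega>))))
    \<longleftrightarrow> full_scenario t x {\<omega>\<in>space M. \<tau> \<omega> \<in> t_min (\<omega> (\<tau> \<omega>))}"
proof -
  note range = rule_range[OF assms(2,3)]
  have "EE t x (reward t \<tau> (\<lambda>\<omega>. f (\<omega> (\<tau> \<omega>)))) = EE t x (reward t \<tau> (\<lambda>\<omega>. v (\<tau> \<omega>) (\<omega> (\<tau> \<omega>))))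
      \<longleftrightarrow> full_scenario t x {\<omega>\<in>space M. f (\<omega> (\<tau> \<omega>)) = v (\<tau> \<omega>) (\<omega> (\<tau> \<omega>))}"
    using f_le_v[OF assms(1) range]
    by (intro EE_reward_eq_iff[OF assms(2,3)] stopped_value_H[OF assms(2,3)])
  also have "{\<omega>\<in>space M. f (\<omega> (\<tau> \<omega>)) = v (\<tau> \<omega>) (\<omega> (\<tau> \<omega>))}
      = {\<omega>\<in>space M. \<tau> \<omega> \<in> t_min (\<omega> (\<tau> \<omega>))}"
    using f_eq_v_iff[OF assms(1) range] by blast
  finally have event: "EE t x (reward t \<tau> (\<lambda>\<omega>. f (\<omega> (\<tau> \<omega>)))) = EE t x (reward t \<tau> (\<lambda>\<omega>. v (\<tau> \<omega>) (\<omega> (\<tau> \<omega>))))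
      \<longleftrightarrow> full_scenario t x {\<omega>\<in>space M. \<tau> \<omega> \<in> t_min (\<omega> (\<tau> \<omega>))}" .
  show ?thesis
    \<comment> \<open>What remains is to cancel the factor \<open>B t\<close>, which is
      positive.\<close>
    unfolding event[symmetric] E_VI[OF assms(2,3)]
    using B_pos[of t] assms(2) by auto
qed

text \<open>Mirror image of the case of \<open>f\<close>: here \<open>v\<close> is the smaller
  payoff and \<open>h\<close> the larger one.\<close>

lemma v_eq_h_reward_iff:
  assumes "continuous_on ({0..T} \<times> UNIV) (\<lambda>(s, y). v s y)" "t \<in> {0..T}" "\<tau> \<in> \<T> t"
  shows "v t x = B t * EE t x (reward t \<tau> (\<lambda>\<omega>. h (\<omega> (\<tau> \<omega>))))
    \<longleftrightarrow> full_scenario t x {\<omega>\<in>space M. \<tau> \<omega> \<in> t_max (\<omega> (\<tau> \<omega>))}"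
proof -
  note range = rule_range[OF assms(2,3)]
  have "EE t x (reward t \<tau> (\<lambda>\<omega>. v (\<tau> \<omega>) (\<omega> (\<tau> \<omega>)))) = EE t x (reward t \<tau> (\<lambda>\<omega>. h (\<omega> (\<tau> \<omega>))))
      \<longleftrightarrow> full_scenario t x {\<omega>\<in>space M. v (\<tau> \<omega>) (\<omega> (\<tau> \<omega>)) = h (\<omega> (\<tau> \<omega>))}"
    using v_le_h[OF assms(1) range]
    by (intro EE_reward_eq_iff[OF assms(2,3)] stopped_value_H[OF assms(2,3)])
  also have "{\<omega>\<in>space M. v (\<tau> \<omega>) (\<omega> (\<tau> \<omega>)) = h (\<omega> (\<tau> \<omega>))}
      = {\<omega>\<in>space M. \<tau> \<omega> \<in> t_max (\<omega> (\<tau> \<omega>))}"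
    using v_eq_h_iff[OF assms(1) range] by blast
  finally have event: "EE t x (reward t \<tau> (\<lambda>\<omega>. v (\<tau> \<omega>) (\<omega> (\<tau> \<omega>)))) = EE t x (reward t \<tau> (\<lambda>\<omega>. h (\<omega> (\<tau> \<omega>))))
      \<longleftrightarrow> full_scenario t x {\<omega>\<in>space M. \<tau> \<omega> \<in> t_max (\<omega> (\<tau> \<omega>))}" .
  show ?thesis
    unfolding event[symmetric] E_VI[OF assms(2,3)]
    using B_pos[of t] assms(2) by auto
qed

text \<open>The value \<open>v t x\<close> bounds every candidate in the supremum, and the given
  \<open>\<tau>\<close> attains it, so \<open>\<tau>\<close> is optimal. In \<open>ereal\<close> the
  supremum needs no boundedness side condition.\<close>

lemma u_eq_v:
  assumes "continuous_on ({0..T} \<times> UNIV) (\<lambda>(s, y). v s y)" "t \<in> {0..T}" "\<tau> \<in> \<T> t"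
    and "v t x = B t * EE t x (reward t \<tau> (\<lambda>\<omega>. f (\<omega> (\<tau> \<omega>))))"
  shows "u t x = ereal (v t x)"
proof (rule antisym)
  show "u t x \<le> ereal (v t x)"
    unfolding u_def by (rule SUP_least) (simp add: f_reward_le_v[OF assms(1,2)])
  show "ereal (v t x) \<le> u t x"
    unfolding u_def assms(4) by (rule SUP_upper[OF assms(3)])
qed

lemma w_eq_v:
  assumes "continuous_on ({0..T} \<times> UNIV) (\<lambda>(s, y). v s y)" "t \<in> {0..T}" "\<tau> \<in> \<T> t"
    and "v t x = B t * EE t x (reward t \<tau> (\<lambda>\<omega>. h (\<omega> (\<tau> \<omega>))))"
  shows "w t x = ereal (v t x)"
proof (rule antisym)
  show "ereal (v t x) \<le> w t x"
    unfolding w_def by (rule INF_greatest) (simp add: v_le_h_reward[OF assms(1,2)])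
  show "w t x \<le> ereal (v t x)"
    unfolding w_def assms(4) by (rule INF_lower[OF assms(3)])
qed

end

theorem theorem2p6:
  fixes M :: "(real \<Rightarrow> 'e::polish_space) measure"
    and T t :: real
    and B :: "real \<Rightarrow> real"
    and \<T> :: "real \<Rightarrow> ((real \<Rightarrow> 'e) \<Rightarrow> real) set"
    and H :: "((real \<Rightarrow> 'e) \<Rightarrow> real) set"
    and EE :: "real \<Rightarrow> 'e \<Rightarrow> ((real \<Rightarrow> 'e) \<Rightarrow> real) \<Rightarrow> real"
    and rho :: "real \<Rightarrow> real \<Rightarrow> (real \<Rightarrow> 'e) \<Rightarrow> (real \<Rightarrow> real) \<Rightarrow> real"
    and g :: "'e \<Rightarrow> real"
    and x :: 'e
  assumes "nonlinear_expectation_setting M T B \<T> H EE rho g"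
    and "continuous_on ({0..T} \<times> UNIV) (\<lambda>(s, y). path_setting.v M T B EE rho g s y)"
    and "t \<in> {0..T}"
  shows "(\<forall>\<tau>\<in>\<T> t.
      (path_setting.v M T B EE rho g t x
         = B t * EE t x (path_setting.reward M T B rho t \<tau>
             (\<lambda>\<omega>. path_setting.f M T B EE rho g (\<omega> (\<tau> \<omega>))))
       \<longleftrightarrow> path_setting.full_scenario M H EE t x
             {\<omega>\<in>space M. \<tau> \<omega> \<in> path_setting.t_min M T B EE rho g (\<omega> (\<tau> \<omega>))})
      \<and> (path_setting.full_scenario M H EE t x
             {\<omega>\<in>space M. \<tau> \<omega> \<in> path_setting.t_min M T B EE rho g (\<omega> (\<tau> \<omega>))}
         \<longrightarrow> path_setting.u M T B \<T> EE rho g t x = ereal (path_setting.v M T B EE rho g t x)))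
    \<and> (\<forall>\<tau>\<in>\<T> t.
      (path_setting.v M T B EE rho g t x
         = B t * EE t x (path_setting.reward M T B rho t \<tau>
             (\<lambda>\<omega>. path_setting.h M T B EE rho g (\<omega> (\<tau> \<omega>))))
       \<longleftrightarrow> path_setting.full_scenario M H EE t x
             {\<omega>\<in>space M. \<tau> \<omega> \<in> path_setting.t_max M T B EE rho g (\<omega> (\<tau> \<omega>))})
      \<and> (path_setting.full_scenario M H EE t x
             {\<omega>\<in>space M. \<tau> \<omega> \<in> path_setting.t_max M T B EE rho g (\<omega> (\<tau> \<omega>))}
         \<longrightarrow> path_setting.w M T B \<T> EE rho g t x = ereal (path_setting.v M T B EE rho g t x)))"
proof -
  interpret nonlinear_expectation_setting M T B \<T> H EE rho g
    by (rule assms(1))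
  \<comment> \<open>The second clause of each part starts from fullness of the event; the
    equivalence turns it into the equality of values that \<open>u_eq_v\<close> and
    \<open>w_eq_v\<close> require.\<close>
  show ?thesis
    using v_eq_f_reward_iff[OF assms(2,3)] u_eq_v[OF assms(2,3)]
      v_eq_h_reward_iff[OF assms(2,3)] w_eq_v[OF assms(2,3)]
    by blast
qed

end
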